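(* Let $p$ be an odd prime with $p\neq 17$. (i) If $p\equiv 1\pmod 4$, then $$\sum_{k=0}^{[p/4]}(-1)^k\binom{4k}{2k}\equiv\begin{cases}0\pmod p&\text{if }p\equiv \pm3,\pm5,\pm6,\pm7\pmod{17},\\ 17^{(p-1)/4}\pmod p&\text{if }p\equiv\pm1,\pm4\pmod{17},\\ -17^{(p-1)/4}\pmod p&\text{if }p\equiv\pm2,\pm8\pmod{17}.\end{cases}$$ (ii) If $p\equiv 3\pmod 4$, then $$\sum_{k=0}^{[p/4]}(-1)^k\binom{4k}{2k}\equiv\begin{cases}17^{(p-3)/4}\pmod p&\text{if }p\equiv\pm1,\pm4\pmod{17},\\ -17^{(p-3)/4}\pmod p&\text{if }p\equiv\pm2,\pm8\pmod{17},\\ 4\cdot17^{(p-3)/4}\pmod p&\text{if }p\equiv\pm3,\pm5\pmod{17},\\ -4\cdot17^{(p-3)/4}\pmod p&\text{if }p\equiv\pm6,\pm7\pmod{17}.\end{cases}$$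
   Context: $[x]$ denotes the greatest integer not exceeding $x$. *)

theory Defs
  imports "HOL-Number_Theory.Number_Theory"
begin

end

theory Submission
  imports Defs "HOL-Computational_Algebra.Polynomial"
begin

text \<open>
  With \<open>n = (p - 1)/2\<close> one has \<open>binom(2m, m) \<equiv> (-4)^m binom(n, m)\<close> modulo \<open>p\<close>, so the sum is congruent to
  the real part of \<open>(1 - 4\<i>)^n\<close>. Let \<open>G\<close> be the Gauss sum of the quartic character \<open>\<chi>\<close> modulo 17 with
  \<open>\<chi>(3) = \<i>\<close>. Then \<open>G^4 = 17(1 - 4\<i>)^2\<close>, while the Frobenius congruence gives
  \<open>G(\<chi>)^p \<equiv> \<chi>(p)^(-p) G(\<chi>^p)\<close>. Comparing the two evaluations of \<open>G^(p-1)\<close> for \<open>p \<equiv> 1 (mod 4)\<close>, or of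
  \<open>G^(p+1)\<close> together with \<open>G(\<chi>) G(\<chi>^3) = 17\<close> for \<open>p \<equiv> 3 (mod 4)\<close>, determines \<open>(1 - 4\<i>)^n\<close> up to a power
  of 17; quadratic reciprocity supplies \<open>17^n \<equiv> (p/17)\<close>.
\<close>

section \<open>Polynomials with Gaussian integer coefficients\<close>

definition gauss_ints :: "complex set" where
  "gauss_ints = {x. Re x \<in> \<int> \<and> Im x \<in> \<int>}"

lemma gauss_ints_0: "0 \<in> gauss_ints"
  and gauss_ints_1: "1 \<in> gauss_ints"
  and gauss_ints_i: "\<i> \<in> gauss_ints"
  and gauss_ints_numeral: "numeral k \<in> gauss_ints"
  by (simp_all add: gauss_ints_def)

lemma gauss_ints_add: "a \<in> gauss_ints \<Longrightarrow> b \<in> gauss_ints \<Longrightarrow> a + b \<in> gauss_ints"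
  and gauss_ints_diff: "a \<in> gauss_ints \<Longrightarrow> b \<in> gauss_ints \<Longrightarrow> a - b \<in> gauss_ints"
  and gauss_ints_mult: "a \<in> gauss_ints \<Longrightarrow> b \<in> gauss_ints \<Longrightarrow> a * b \<in> gauss_ints"
  by (auto simp: gauss_ints_def)

lemma gauss_ints_power: "a \<in> gauss_ints \<Longrightarrow> a ^ n \<in> gauss_ints"
  by (induction n) (auto intro: gauss_ints_1 gauss_ints_mult)

lemma gauss_ints_sum: "(\<And>j. j \<in> A \<Longrightarrow> t j \<in> gauss_ints) \<Longrightarrow> sum t A \<in> gauss_ints"
  by (induction A rule: infinite_finite_induct) (auto intro: gauss_ints_0 gauss_ints_add)

text \<open>These stand in for the ring obtained from the Gaussian integers by adjoining a 17th root
  of unity: one polynomial identity can be evaluated at all conjugates at once.\<close>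

definition gauss_polys :: "complex poly set" where
  "gauss_polys = {f. \<forall>n. coeff f n \<in> gauss_ints}"

lemma gauss_polys_0: "0 \<in> gauss_polys"
  and gauss_polys_monom: "c \<in> gauss_ints \<Longrightarrow> monom c n \<in> gauss_polys"
  by (auto simp: gauss_polys_def gauss_ints_0)

lemma gauss_polys_1: "1 \<in> gauss_polys"
  using gauss_polys_monom[OF gauss_ints_1, of 0] by simp

lemma gauss_polys_add: "f \<in> gauss_polys \<Longrightarrow> g \<in> gauss_polys \<Longrightarrow> f + g \<in> gauss_polys"
  by (auto simp: gauss_polys_def intro: gauss_ints_add)

lemma gauss_polys_mult: "f \<in> gauss_polys \<Longrightarrow> g \<in> gauss_polys \<Longrightarrow> f * g \<in> gauss_polys"
  by (auto simp: gauss_polys_def coeff_mult intro!: gauss_ints_sum gauss_ints_mult)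

lemma gauss_polys_sum: "(\<And>j. j \<in> A \<Longrightarrow> t j \<in> gauss_polys) \<Longrightarrow> sum t A \<in> gauss_polys"
  by (induction A rule: infinite_finite_induct) (auto intro: gauss_polys_0 gauss_polys_add)

lemma gauss_polys_power: "f \<in> gauss_polys \<Longrightarrow> f ^ n \<in> gauss_polys"
  by (induction n) (auto intro: gauss_polys_1 gauss_polys_mult)

lemma gauss_polys_of_nat: "of_nat n \<in> gauss_polys"
  by (induction n) (auto intro: gauss_polys_0 gauss_polys_1 gauss_polys_add)

section \<open>The Frobenius congruence modulo \<open>p\<close>\<close>

lemma gauss_polys_frobenius_add:
  assumes "prime p" "f \<in> gauss_polys" "g \<in> gauss_polys"
  shows "\<exists>r\<in>gauss_polys. (f + g) ^ p = f ^ p + g ^ p + of_nat p * r"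
proof -
  \<comment> \<open>The division by \<open>p\<close> is exact, since a prime \<open>p\<close>
    divides every inner binomial coefficient of the \<open>p\<close>-th row.\<close>
  define r where "r = (\<Sum>k\<in>{1..<p}. of_nat ((p choose k) div p) * f ^ k * g ^ (p - k))"
  have p: "p > 0" using assms(1) prime_gt_0_nat by blast
  have "{..p} = insert 0 (insert p {1..<p})" using p by auto
  then have "(f + g) ^ p = g ^ p + (f ^ p + (\<Sum>k\<in>{1..<p}. of_nat (p choose k) * f ^ k * g ^ (p - k)))"
    using p by (simp add: binomial_ring)
  also have "(\<Sum>k\<in>{1..<p}. of_nat (p choose k) * f ^ k * g ^ (p - k)) = of_nat p * r"
    unfolding r_def sum_distrib_left
  proof (rule sum.cong[OF refl])
    fix k assume "k \<in> {1..<p}"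
    then have "p dvd (p choose k)" using assms(1) p by (intro dvd_choose_prime) auto
    then have "(of_nat (p choose k) :: complex poly) = of_nat p * of_nat ((p choose k) div p)"
      by (metis dvd_mult_div_cancel of_nat_mult)
    then show "of_nat (p choose k) * f ^ k * g ^ (p - k) =
        of_nat p * (of_nat ((p choose k) div p) * f ^ k * g ^ (p - k))"
      by (simp add: mult.assoc)
  qed
  finally have "(f + g) ^ p = f ^ p + g ^ p + of_nat p * r" by (simp add: algebra_simps)
  moreover have "r \<in> gauss_polys"
    unfolding r_def using assms
    by (intro gauss_polys_sum gauss_polys_mult gauss_polys_power gauss_polys_of_nat) auto
  ultimately show ?thesis by blast
qed

lemma gauss_polys_frobenius_sum:
  assumes "prime p" "finite A" "\<And>j. j \<in> A \<Longrightarrow> t j \<in> gauss_polys"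
  shows "\<exists>r\<in>gauss_polys. (\<Sum>j\<in>A. t j) ^ p = (\<Sum>j\<in>A. t j ^ p) + of_nat p * r"
  using assms(2,3)
proof (induction A rule: finite_induct)
  case empty
  show ?case using assms(1) gauss_polys_0 prime_gt_0_nat[of p] by (auto intro!: bexI[of _ 0])
next
  case (insert a A)
  obtain r where r: "r \<in> gauss_polys" "(\<Sum>j\<in>A. t j) ^ p = (\<Sum>j\<in>A. t j ^ p) + of_nat p * r"
    using insert by auto
  obtain s where s: "s \<in> gauss_polys"
    "(t a + (\<Sum>j\<in>A. t j)) ^ p = t a ^ p + (\<Sum>j\<in>A. t j) ^ p + of_nat p * s"
    using gauss_polys_frobenius_add[OF assms(1), of "t a" "\<Sum>j\<in>A. t j"] insert
    by (auto intro: gauss_polys_sum)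
  show ?case
    using r s insert by (intro bexI[of _ "r + s"]) (auto simp: algebra_simps intro: gauss_polys_add)
qed

section \<open>The nontrivial 17th roots of unity\<close>

definition root17 :: complex where "root17 = cis (2 * pi / 17)"

lemma root17_power: "root17 ^ 17 = 1"
  by (simp add: root17_def Complex.DeMoivre)

lemma root17_power_neq_1:
  assumes "0 < j" "j < 17"
  shows "root17 ^ j \<noteq> 1"
proof
  assume "root17 ^ j = 1"
  then have "cis (real j * (2 * pi / 17)) = 1"
    by (simp add: root17_def Complex.DeMoivre)
  then have "cos (real j * (2 * pi / 17)) = 1"
    by (metis cis.sel(1) one_complex.sel(1))
  then obtain n :: int where "real j * (2 * pi / 17) = of_int n * 2 * pi"
    by (auto simp: cos_one_2pi_int)
  then have "real j = of_int (17 * n)" by (simp add: field_simps)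
  then have "int j = 17 * n" by linarith
  then show False using assms by presburger
qed

lemma sum_powers_17th_root:
  fixes z :: complex
  assumes "z ^ 17 = 1" "z \<noteq> 1"
  shows "(\<Sum>k<17. z ^ k) = 0"
proof -
  have "(z - 1) * (\<Sum>k<17. z ^ k) = 0"
    using assms(1) by (simp only: power_diff_1_eq[symmetric]) simp
  then show ?thesis using assms(2) by simp
qed

text \<open>This is the trace down to the Gaussian rationals. By linearity it suffices to sum the
  \<open>k\<close>-th powers of the 16 nontrivial roots, which gives 16 if
  \<open>root17 ^ k = 1\<close> and -1 otherwise.\<close>

lemma trace_gauss_poly:
  assumes "f \<in> gauss_polys"
  shows "(\<Sum>j=1..16. poly f (root17 ^ j)) \<in> gauss_ints"
proof -
  have pow: "(\<Sum>j=1..16. (root17 ^ j) ^ k) \<in> gauss_ints" for k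
  proof (cases "root17 ^ k = 1")
    case True
    then have "(root17 ^ j) ^ k = 1" for j by (metis power_commutes power_mult power_one mult.commute)
    then show ?thesis by (simp add: gauss_ints_numeral)
  next
    case False
    have "(root17 ^ k) ^ 17 = 1" by (metis root17_power power_mult mult.commute power_one)
    then have "(\<Sum>j<17. (root17 ^ k) ^ j) = 0" using False by (rule sum_powers_17th_root)
    moreover have "{..<17} = insert 0 {1..16::nat}" by auto
    ultimately have "1 + (\<Sum>j=1..16. (root17 ^ k) ^ j) = 0" by simp
    then have "(\<Sum>j=1..16. (root17 ^ j) ^ k) = 0 - 1"
      by (simp add: power_mult[symmetric] mult.commute[of k] eq_neg_iff_add_eq_0 add.commute)
    then show ?thesis using gauss_ints_diff[OF gauss_ints_0 gauss_ints_1] by simp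
  qed
  have "(\<Sum>j=1..16. poly f (root17 ^ j)) =
      (\<Sum>k\<le>degree f. coeff f k * (\<Sum>j=1..16. (root17 ^ j) ^ k))"
    unfolding poly_altdef sum_distrib_left by (rule sum.swap)
  also have "\<dots> \<in> gauss_ints"
    by (rule gauss_ints_sum, rule gauss_ints_mult[OF _ pow]) (use assms in \<open>simp add: gauss_polys_def\<close>)
  finally show ?thesis .
qed

text \<open>Averaging over the conjugates replaces the fact that \<open>\<rat>(\<i>)\<close> contains no algebraic
  integers outside \<open>\<int>[\<i>]\<close>.\<close>

lemma gauss_poly_constant_dvd:
  assumes "f \<in> gauss_polys"
    and "\<And>z. z ^ 17 = 1 \<Longrightarrow> z \<noteq> 1 \<Longrightarrow> c = of_nat p * poly f z"
  shows "\<exists>g\<in>gauss_ints. 16 * c = of_nat p * g"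
proof -
  have "c = of_nat p * poly f (root17 ^ j)" if "j \<in> {1..16}" for j
  proof (rule assms(2))
    show "(root17 ^ j) ^ 17 = 1" by (metis root17_power power_mult mult.commute power_one)
    show "root17 ^ j \<noteq> 1" using that by (intro root17_power_neq_1) auto
  qed
  \<comment> \<open>The constant \<open>c\<close> is counted once per conjugate, hence the factor
    16.\<close>
  then have "(\<Sum>j=1..(16::nat). c) = (\<Sum>j=1..16. of_nat p * poly f (root17 ^ j))"
    by (intro sum.cong) auto
  then have "16 * c = of_nat p * (\<Sum>j=1..16. poly f (root17 ^ j))"
    by (simp add: sum_distrib_left)
  then show ?thesis using trace_gauss_poly[OF assms(1)] by blast
qed

section \<open>The quartic Gauss sum modulo 17\<close>

text \<open>As 3 is a primitive root modulo 17, this is the Gauss sum of the character with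
  \<open>\<chi>(3) = c\<close> whenever \<open>c ^ 4 = 1\<close>.\<close>

definition gauss_sum17 :: "complex \<Rightarrow> complex \<Rightarrow> complex" where
  "gauss_sum17 c z = (\<Sum>j<16. c ^ j * z ^ (3 ^ j))"

lemma power_cong_17:
  fixes z :: complex
  assumes "z ^ 17 = 1" "[a = b] (mod 17)"
  shows "z ^ a = z ^ b"
proof -
  have "z ^ n = z ^ (n mod 17)" for n
  proof -
    have "z ^ n = z ^ (17 * (n div 17) + n mod 17)" by simp
    also have "\<dots> = z ^ (n mod 17)" by (simp only: power_add power_mult assms(1)) simp
    finally show ?thesis .
  qed
  then show ?thesis using assms(2) unfolding cong_def by metis
qed

text \<open>The brackets are the four quartic Gaussian periods: the exponents in \<open>u\<close>
  run over the cosets of 1 and 9 = 3^2 modulo the fourth powers, those in \<open>v\<close> over the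
  cosets of 3 and 10 = 3^3. Thus \<open>d\<close> is the quadratic Gauss sum.\<close>

lemma gaussian_periods_17:
  fixes z :: complex
  assumes "z ^ 17 = 1" "z \<noteq> 1"
  defines "u \<equiv> z + z^13 + z^16 + z^4 - (z^9 + z^15 + z^8 + z^2)"
    and "v \<equiv> z^3 + z^5 + z^14 + z^12 - (z^10 + z^11 + z^7 + z^6)"
    and "d \<equiv> z + z^13 + z^16 + z^4 + (z^9 + z^15 + z^8 + z^2)
          - (z^3 + z^5 + z^14 + z^12) - (z^10 + z^11 + z^7 + z^6)"
  shows "u^2 + v^2 = 17" "u^2 - v^2 = - d" "u * v = 2 * d" "d^2 = 17"
proof -
  have "z ^ 16 + (1 + z + z^2 + z^3 + z^4 + z^5 + z^6 + z^7 + z^8 + z^9 + z^10 + z^11 + z^12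
      + z^13 + z^14 + z^15) = 0"
    using sum_powers_17th_root[OF assms(1,2)] by (simp add: lessThan_nat_numeral lessThan_Suc add_ac)
  \<comment> \<open>Products are first reduced to exponents below 17; eliminating
    \<open>z ^ 16\<close> then leaves expressions in 1, ..., \<open>z ^ 15\<close> whose
    coefficients can be compared.\<close>
  then have z16: "z ^ 16 = - (1 + z + z^2 + z^3 + z^4 + z^5 + z^6 + z^7 + z^8 + z^9 + z^10 + z^11
      + z^12 + z^13 + z^14 + z^15)"
    by (simp only: eq_neg_iff_add_eq_0)
  have red: "z ^ (17 + k) = z ^ k" for k by (simp add: power_add assms(1))
  note reds = assms(1) red[of 1, simplified] red[of 2, simplified] red[of 3, simplified]
    red[of 4, simplified] red[of 5, simplified] red[of 6, simplified] red[of 7, simplified]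
    red[of 8, simplified] red[of 9, simplified] red[of 10, simplified] red[of 11, simplified]
    red[of 12, simplified] red[of 13, simplified] red[of 14, simplified] red[of 15, simplified]
  have mult: "z ^ a * z ^ b = z ^ (a + b)" "z * z ^ b = z ^ Suc b" "z ^ b * z = z ^ Suc b"
    "z * z = z ^ 2" for a b
    by (simp_all add: power_add power2_eq_square)
  show "u^2 + v^2 = 17" "u^2 - v^2 = - d" "u * v = 2 * d" "d^2 = 17"
    unfolding u_def v_def d_def power2_eq_square[of "_ - _"] power2_eq_square[of "_ + _"]
    by (simp_all only: ring_distribs mult) (simp_all add: reds, simp_all add: z16)
qed

text \<open>Powers of \<open>c\<close> have period 4, so collecting exponents by cosets of the
  fourth powers gives \<open>u + c * v\<close> in the periods above.\<close>

lemma gauss_sum17_expand: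
  fixes z :: complex
  assumes "z ^ 17 = 1" "c ^ 2 = - 1"
  shows "gauss_sum17 c z = z + z^13 + z^16 + z^4 - (z^9 + z^15 + z^8 + z^2)
    + c * (z^3 + z^5 + z^14 + z^12 - (z^10 + z^11 + z^7 + z^6))"
proof -
  have c: "c ^ (2 * k) = (- 1) ^ k" "c ^ Suc (2 * k) = c * (- 1) ^ k" for k
    using assms(2) by (simp_all add: power_mult)
  have c': "c ^ 2 = - 1" "c ^ 3 = - c" "c ^ 4 = 1" "c ^ 5 = c" "c ^ 6 = - 1" "c ^ 7 = - c"
    "c ^ 8 = 1" "c ^ 9 = c" "c ^ 10 = - 1" "c ^ 11 = - c" "c ^ 12 = 1" "c ^ 13 = c"
    "c ^ 14 = - 1" "c ^ 15 = - c"
    using c(1)[of 1] c(1)[of 2] c(1)[of 3] c(1)[of 4] c(1)[of 5] c(1)[of 6] c(1)[of 7]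
      c(2)[of 1] c(2)[of 2] c(2)[of 3] c(2)[of 4] c(2)[of 5] c(2)[of 6] c(2)[of 7]
    by simp_all
  have red: "z ^ a = z ^ (a mod 17)" for a
    by (rule power_cong_17[OF assms(1)]) (simp add: cong_def)
  have z': "z ^ 27 = z ^ 10" "z ^ 81 = z ^ 13" "z ^ 243 = z ^ 5" "z ^ 729 = z ^ 15"
    "z ^ 2187 = z ^ 11" "z ^ 6561 = z ^ 16" "z ^ 19683 = z ^ 14" "z ^ 59049 = z ^ 8"
    "z ^ 177147 = z ^ 7" "z ^ 531441 = z ^ 4" "z ^ 1594323 = z ^ 12" "z ^ 4782969 = z ^ 2"
    "z ^ 14348907 = z ^ 6"
    using red[of 27] red[of 81] red[of 243] red[of 729] red[of 2187] red[of 6561] red[of 19683]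
      red[of 59049] red[of 177147] red[of 531441] red[of 1594323] red[of 4782969] red[of 14348907]
    by simp_all
  show ?thesis
    unfolding gauss_sum17_def
    by (simp add: lessThan_nat_numeral lessThan_Suc c' z' algebra_simps)
qed

text \<open>The square of the Gauss sum is the quadratic Gauss sum \<open>d\<close> times the Jacobi
  sum \<open>- (1 - 4 * \<i>)\<close>; squaring again turns \<open>d\<close> into 17.\<close>

lemma gauss_sum17_power_4:
  fixes z :: complex
  assumes "z ^ 17 = 1" "z \<noteq> 1"
  shows "gauss_sum17 \<i> z ^ 4 = 17 * (1 - 4 * \<i>) ^ 2"
proof -
  note periods = gaussian_periods_17[OF assms]
  have alg: "(u + \<i> * v) ^ 4 = 17 * (1 - 4 * \<i>) ^ 2"
    if "u^2 - v^2 = - d" "u * v = 2 * d" "d^2 = 17" for u v d :: complex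
  proof -
    have "(u + \<i> * v) ^ 2 = (u^2 - v^2) + 2 * \<i> * (u * v)"
      by (simp add: power2_eq_square algebra_simps)
    also have "\<dots> = - d * (1 - 4 * \<i>)" using that by (simp add: algebra_simps)
    finally have "((u + \<i> * v) ^ 2) ^ 2 = d^2 * (1 - 4 * \<i>) ^ 2" by (simp add: power_mult_distrib)
    then show ?thesis using that(3) by (simp flip: power_mult)
  qed
  show ?thesis
    unfolding gauss_sum17_expand[OF assms(1) power2_i] by (rule alg[OF periods(2,3,4)])
qed

text \<open>The argument \<open>- \<i>\<close> gives the conjugate character, and the product is
  \<open>u^2 + v^2\<close> in the periods.\<close>

lemma gauss_sum17_mult_conjugate:
  fixes z :: complex
  assumes "z ^ 17 = 1" "z \<noteq> 1"
  shows "gauss_sum17 \<i> z * gauss_sum17 (- \<i>) z = 17"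
proof -
  have alg: "(u + \<i> * v) * (u + - \<i> * v) = u^2 + v^2" for u v :: complex
    by (simp add: power2_eq_square algebra_simps)
  have mi: "(- \<i>) ^ 2 = - 1" by simp
  show ?thesis
    unfolding gauss_sum17_expand[OF assms(1) power2_i] gauss_sum17_expand[OF assms(1) mi] alg
    by (rule gaussian_periods_17[OF assms])
qed

text \<open>Reindexing the sum by a power of the primitive root 3 pulls out the inverse character
  value \<open>c ^ (- m)\<close>, written \<open>c ^ (3 * m)\<close> because
  \<open>c ^ 4 = 1\<close>.\<close>

lemma gauss_sum17_shift:
  fixes z :: complex
  assumes "z ^ 17 = 1" "c ^ 4 = 1"
  shows "gauss_sum17 c (z ^ (3 ^ m)) = c ^ (3 * m) * gauss_sum17 c z"
proof (induction m)
  case 0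
  show ?case by simp
next
  case (Suc m)
  have step: "gauss_sum17 c (y ^ 3) = c ^ 3 * gauss_sum17 c y" if y: "y ^ 17 = 1" for y
  proof -
    have c: "c ^ (3 + Suc j) = c ^ j" for j
      using assms(2) by (simp add: power_add[of c 4 j, simplified] flip: power_Suc)
    define h where "h j = c ^ (3 + j) * y ^ (3 ^ j)" for j
    have "gauss_sum17 c (y ^ 3) = (\<Sum>j<16. h (Suc j))"
      unfolding gauss_sum17_def h_def c by (simp add: power_mult)
    also have "\<dots> = (\<Sum>j<Suc 16. h j) - h 0" by (simp only: sum.lessThan_Suc_shift) simp
    also have "\<dots> = (\<Sum>j<16. h j)"
    proof -
      \<comment> \<open>The shifted index wraps around: 3^16 is 1 modulo 17 and
        \<open>c ^ 16 = 1\<close>.\<close>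
      have "h 16 = h 0"
      proof -
        have "y ^ (3 ^ 16) = y ^ 1"
          by (rule power_cong_17[OF y]) (simp add: cong_def)
        moreover have "c ^ (3 + 16) = (c ^ 4) ^ 4 * c ^ 3" by (simp flip: power_mult power_add)
        ultimately show ?thesis by (simp add: h_def assms(2))
      qed
      then show ?thesis by (simp only: sum.lessThan_Suc) simp
    qed
    also have "\<dots> = c ^ 3 * gauss_sum17 c y"
      unfolding gauss_sum17_def h_def by (simp add: sum_distrib_left power_add mult.assoc)
    finally show ?thesis .
  qed
  have "(z ^ (3 ^ m)) ^ 17 = 1"
    by (metis assms(1) power_mult mult.commute power_one)
  then have "gauss_sum17 c ((z ^ (3 ^ m)) ^ 3) = c ^ 3 * gauss_sum17 c (z ^ (3 ^ m))" by (rule step)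
  then show ?case by (simp add: Suc power_add mult.commute flip: power_mult)
qed

lemma gauss_sum17_poly:
  obtains G where "G \<in> gauss_polys" "\<And>z. poly G z = gauss_sum17 \<i> z"
proof
  let ?G = "\<Sum>j<16. monom (\<i> ^ j) (3 ^ j)"
  show "?G \<in> gauss_polys"
    by (intro gauss_polys_sum gauss_polys_monom gauss_ints_power gauss_ints_i)
  show "poly ?G z = gauss_sum17 \<i> z" for z
    by (simp add: gauss_sum17_def poly_monom poly_sum)
qed

text \<open>Frobenius raises both the character values and \<open>z\<close> to the
  \<open>p\<close>-th power; the shift by \<open>p = 3 ^ m\<close> modulo 17 then restores
  \<open>z\<close>. The remainder \<open>r\<close> does not depend on \<open>z\<close>, as the
  averaging argument requires.\<close>

lemma gauss_sum17_frobenius: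
  assumes "prime p" "[p = 3 ^ m] (mod 17)"
  shows "\<exists>r\<in>gauss_polys. \<forall>z. z ^ 17 = 1 \<longrightarrow>
    gauss_sum17 \<i> z ^ p = (\<i> ^ p) ^ (3 * m) * gauss_sum17 (\<i> ^ p) z + of_nat p * poly r z"
proof -
  define t where "t j = monom (\<i> ^ j) (3 ^ j)" for j :: nat
  have "t j \<in> gauss_polys" for j
    unfolding t_def by (intro gauss_polys_monom gauss_ints_power gauss_ints_i)
  then obtain r where r: "r \<in> gauss_polys"
    "(\<Sum>j<16. t j) ^ p = (\<Sum>j<16. t j ^ p) + of_nat p * r"
    using gauss_polys_frobenius_sum[OF assms(1), of "{..<16}" t] by auto
  have "gauss_sum17 \<i> z ^ p = (\<i> ^ p) ^ (3 * m) * gauss_sum17 (\<i> ^ p) z + of_nat p * poly r z"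
    if z: "z ^ 17 = 1" for z
  proof -
    have ip: "(\<i> ^ p) ^ 4 = 1"
    proof -
      have "(\<i> ^ p) ^ 4 = (\<i> ^ 4) ^ p" by (simp only: mult.commute flip: power_mult)
      then show ?thesis by simp
    qed
    have "poly ((\<Sum>j<16. t j) ^ p) z = gauss_sum17 \<i> z ^ p"
      by (simp add: t_def gauss_sum17_def poly_monom poly_sum)
    moreover have "poly (\<Sum>j<16. t j ^ p) z = gauss_sum17 (\<i> ^ p) (z ^ p)"
      by (simp add: t_def gauss_sum17_def poly_monom poly_sum power_mult_distrib mult.commute
          flip: power_mult)
    moreover have "z ^ p = z ^ (3 ^ m)" by (rule power_cong_17[OF z assms(2)])
    ultimately show ?thesis
      using r(2) gauss_sum17_shift[OF z ip] by simp
  qed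
  then show ?thesis using r(1) by blast
qed

section \<open>Reduction of the binomial sum\<close>

text \<open>Modulo \<open>p\<close>, \<open>n\<close> is -1/2, and the central binomial coefficient
  is \<open>(- 4) ^ m\<close> times the generalized one of -1/2 over \<open>m\<close>. The induction
  compares the ratios of consecutive terms.\<close>

lemma central_binomial_cong:
  assumes "prime p" "p = 2 * n + 1" "m \<le> n"
  shows "[int ((2 * m) choose m) = (- 4) ^ m * int (n choose m)] (mod int p)"
  using assms(3)
proof (induction m)
  case 0
  show ?case by simp
next
  case (Suc m)
  \<comment> \<open>\<open>Suc m\<close> is at most \<open>n\<close>, hence below \<open>p\<close>,
    and may be cancelled at the end.\<close>
  have "\<not> p dvd Suc m" using Suc.prems assms(2) by (auto dest: dvd_imp_le)
  then have cop: "coprime (int (Suc m)) (int p)"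
    using assms(1) by (metis coprime_commute coprime_int_iff prime_imp_coprime)
  have "Suc m * ((2 * Suc m) choose Suc m) = 2 * (2 * m + 1) * ((2 * m) choose m)"
  proof -
    have a: "Suc m * (Suc (2 * m) choose Suc m) = (2 * m + 1) * ((2 * m) choose m)"
      using Suc_times_binomial[of m "2 * m"] by simp
    have "Suc (2 * m) choose m = Suc (2 * m) choose Suc m"
      using binomial_symmetric[of m "Suc (2 * m)"] by simp
    then have "(2 * Suc m) choose Suc m = 2 * (Suc (2 * m) choose Suc m)" by simp
    then show ?thesis using a by (metis mult.assoc mult.left_commute)
  qed
  then have "int (Suc m) * int ((2 * Suc m) choose Suc m)
      = 2 * (2 * int m + 1) * int ((2 * m) choose m)"
    by (metis (no_types, lifting) of_nat_mult of_nat_add of_nat_numeral of_nat_1)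
  also have "[\<dots> = - 4 * (int n - int m) * ((- 4) ^ m * int (n choose m))] (mod int p)"
  proof (rule cong_mult[OF _ Suc.IH])
    have "2 * (2 * int m + 1) - (- 4 * (int n - int m)) = 2 * int p" by (simp add: assms(2))
    then show "[2 * (2 * int m + 1) = - 4 * (int n - int m)] (mod int p)"
      by (metis cong_iff_dvd_diff dvd_triv_right)
  qed (use Suc.prems in simp)
  also have "- 4 * (int n - int m) * ((- 4) ^ m * int (n choose m))
      = int (Suc m) * ((- 4) ^ Suc m * int (n choose Suc m))"
  proof -
    have "Suc m * (n choose Suc m) = (n - m) * (n choose m)"
      by (metis binomial_absorption binomial_absorb_comp)
    then have "int (Suc m) * int (n choose Suc m) = (int n - int m) * int (n choose m)"
      using Suc.prems by (metis Suc_leD of_nat_diff of_nat_mult)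
    then show ?thesis
      by (metis (no_types, lifting) power_Suc mult.assoc mult.left_commute)
  qed
  finally show ?case using cop by (simp only: cong_mult_lcancel)
qed

text \<open>Only the even powers in the binomial expansion are real, and \<open>- 4 * \<i>\<close>
  has square -16.\<close>

lemma Re_power_1_minus_4i:
  "Re ((1 - 4 * \<i>) ^ n) = of_int (\<Sum>k=0..n div 2. (- 16) ^ k * int (n choose (2 * k)))"
proof -
  define h where "h k = Re (of_nat (n choose k) * (- 4 * \<i>) ^ k)" for k
  have "(1 - 4 * \<i>) ^ n = (- 4 * \<i> + 1) ^ n" by simp
  also have "\<dots> = (\<Sum>k\<le>n. of_nat (n choose k) * (- 4 * \<i>) ^ k)"
    by (simp only: binomial_ring power_one mult_1_right)
  finally have "Re ((1 - 4 * \<i>) ^ n) = (\<Sum>k\<le>n. h k)" by (simp only: h_def Re_sum)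
  also have "\<dots> = (\<Sum>k\<in>(\<lambda>k. 2 * k) ` {0..n div 2}. h k)"
  proof (rule sum.mono_neutral_right)
    show "\<forall>k\<in>{..n} - (\<lambda>k. 2 * k) ` {0..n div 2}. h k = 0"
    proof
      fix k assume k: "k \<in> {..n} - (\<lambda>k. 2 * k) ` {0..n div 2}"
      have "odd k"
      proof
        assume "even k"
        then obtain j where "k = 2 * j" by blast
        then show False using k by auto
      qed
      then obtain j where "k = 2 * j + 1" by (rule oddE)
      moreover have "(- 4 * \<i>) ^ (2 * j + 1) = complex_of_real ((- 16) ^ j) * (- 4 * \<i>)"
        by (simp add: power_mult power_mult_distrib)
      ultimately show "h k = 0" by (simp add: h_def)
    qed
  qed auto
  also have "\<dots> = (\<Sum>k=0..n div 2. h (2 * k))"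
    by (subst sum.reindex) (auto simp: inj_on_def)
  also have "\<dots> = (\<Sum>k=0..n div 2. of_int ((- 16) ^ k * int (n choose (2 * k))))"
  proof (rule sum.cong[OF refl])
    fix k
    have "(- 4 * \<i>) ^ (2 * k) = complex_of_real ((- 16) ^ k)"
      by (simp add: power_mult power_mult_distrib)
    then show "h (2 * k) = of_int ((- 16) ^ k * int (n choose (2 * k)))"
      by (simp only: h_def) simp
  qed
  finally show ?thesis by simp
qed

lemma binomial_sum_cong:
  assumes "prime p" "p = 2 * n + 1" "of_int S = Re ((1 - 4 * \<i>) ^ n)"
  shows "[(\<Sum>k=0..p div 4. (-1) ^ k * int ((4 * k) choose (2 * k))) = S] (mod int p)"
proof -
  have S: "S = (\<Sum>k=0..n div 2. (- 16) ^ k * int (n choose (2 * k)))"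
    using assms(3) unfolding Re_power_1_minus_4i by (simp only: of_int_eq_iff)
  have "p div 4 = n div 2" using assms(2) by presburger
  moreover have "[(-1) ^ k * int ((4 * k) choose (2 * k)) = (- 16) ^ k * int (n choose (2 * k))] (mod int p)"
    if "k \<in> {0..n div 2}" for k
  proof -
    have "2 * k \<le> n" using that by auto
    then have "[int ((2 * (2 * k)) choose (2 * k)) = (- 4) ^ (2 * k) * int (n choose (2 * k))] (mod int p)"
      by (rule central_binomial_cong[OF assms(1,2)])
    then have "[(-1) ^ k * int ((4 * k) choose (2 * k)) =
        (-1) ^ k * ((- 4) ^ (2 * k) * int (n choose (2 * k)))] (mod int p)"
      by (intro cong_mult cong_refl) simp
    also have "(-1) ^ k * ((- 4) ^ (2 * k) * int (n choose (2 * k)))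
        = (- 16) ^ k * int (n choose (2 * k))"
      by (simp add: power_mult flip: power_mult_distrib mult.assoc)
    finally show ?thesis .
  qed
  ultimately show ?thesis unfolding S by (simp only:) (rule cong_sum)
qed

section \<open>Evaluation modulo \<open>p\<close>\<close>

text \<open>Since 17 is 1 modulo 4, reciprocity has no sign, and \<open>p\<close> is a square modulo
  17 exactly when \<open>m\<close> is even, because 3 is a nonresidue. Euler's criterion is applied
  modulo 17 and modulo \<open>p\<close>.\<close>

lemma seventeen_power_half_cong:
  assumes "prime p" "odd p" "[p = 3 ^ m] (mod 17)"
  shows "[17 ^ ((p - 1) div 2) = (- 1) ^ m] (mod int p)"
proof -
  have p2: "p > 2" using assms(1,2) prime_ge_2_nat[of p] by (metis even_numeral le_neq_implies_less)
  have p17: "prime (17::nat)" by simp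
  have ne: "p \<noteq> 17"
  proof
    assume "p = 17"
    then have "17 dvd (3::nat) ^ m" using assms(3) by (metis cong_dvd_iff dvd_refl)
    then have "17 dvd (3::nat)" using p17 prime_dvd_power by blast
    then show False by simp
  qed
  have L: "Legendre (int p) (int 17) = (- 1) ^ m"
  proof -
    have "[Legendre (int p) (int 17) = int p ^ ((17 - 1) div 2)] (mod int 17)"
      by (rule euler_criterion) auto
    also have "[int p ^ ((17 - 1) div 2) = int (3 ^ m) ^ ((17 - 1) div 2)] (mod int 17)"
      using assms(3) by (intro cong_pow) (simp only: cong_int_iff)
    also have "int (3 ^ m) ^ ((17 - 1) div 2) = (3 ^ 8) ^ m"
      by (simp only: of_nat_power of_nat_numeral mult.commute[of m] flip: power_mult) simp
    also have "[(3 ^ 8) ^ m = (- 1) ^ m] (mod int 17)"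
      by (rule cong_pow) (simp add: cong_def)
    finally have "[Legendre (int p) 17 = (- 1) ^ m] (mod 17)" by simp
    \<comment> \<open>The values -1, 0 and 1 are distinct modulo 17, so the congruence is an
      equality.\<close>
    moreover have "(- 1 :: int) ^ m = 1 \<or> (- 1 :: int) ^ m = - 1"
      by (cases "even m") auto
    ultimately show ?thesis
      unfolding Legendre_def by (auto simp: cong_def split: if_splits)
  qed
  have "Legendre (int p) (int 17) * Legendre (int 17) (int p) = (-1) ^ ((p - 1) div 2 * ((17 - 1) div 2))"
    using assms p2 ne by (intro Quadratic_Reciprocity) auto
  then have "(- 1) ^ m * Legendre 17 (int p) = 1"
    unfolding L by (simp add: power_mult mult.commute)
  then have "Legendre 17 (int p) = (- 1) ^ m"
    by (cases "even m") auto
  then show ?thesis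
    using euler_criterion[OF assms(1) p2, of 17] by (simp add: cong_sym)
qed

text \<open>The factor 16 comes from averaging over conjugates, the power of 17 from clearing
  \<open>1 - 4 * \<i>\<close> by its conjugate. Both are real and prime to \<open>p\<close>, so they
  drop out after taking real parts.\<close>

lemma Re_dvd_of_gauss_multiple:
  assumes "prime p" "p \<noteq> 2" "p \<noteq> 17"
    and "16 * 17 ^ k * x = of_nat p * g" "g \<in> gauss_ints" "Re x = of_int a"
  shows "int p dvd a"
proof -
  obtain b where b: "Re g = of_int b" using assms(5) by (auto simp: gauss_ints_def elim: Ints_cases)
  have "Re (complex_of_real (16 * 17 ^ k) * x) = Re (complex_of_real (real p) * g)"
    using assms(4) by simp
  then have "of_int (16 * 17 ^ k * a) = (of_int (int p * b) :: real)"
    by (simp only: times_complex.sel Re_complex_of_real Im_complex_of_real assms(6) b) simp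
  then have "int p dvd 16 * 17 ^ k * a" by (simp only: of_int_eq_iff) simp
  moreover have pi: "prime (int p)" using assms(1) by simp
  moreover have "\<not> int p dvd 16"
  proof
    assume "int p dvd 16"
    then have "int p dvd 2 ^ 4" by simp
    then have "int p dvd 2" using pi prime_dvd_power by blast
    then have "p dvd 2" by (simp flip: int_dvd_int_iff)
    then show False using assms(1,2) primes_dvd_imp_eq[of p 2] by simp
  qed
  moreover have "\<not> int p dvd 17 ^ k"
  proof
    assume "int p dvd 17 ^ k"
    then have "int p dvd 17" using pi prime_dvd_power by blast
    then have "p dvd 17" by (simp flip: int_dvd_int_iff)
    then show False using assms(1,3) primes_dvd_imp_eq[of p 17] by simp
  qed
  ultimately show ?thesis by (simp add: prime_dvd_mult_iff)
qed

text \<open>Up to sign, \<open>y\<close> is the inverse of \<open>x\<close>; both will be powers of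
  17 whose product is \<open>17 ^ ((p - 1) div 2)\<close>.\<close>

lemma cong_solve_sign:
  fixes S :: int
  assumes "[x * S = a] (mod n)" "[y * x = (- 1) ^ m] (mod n)"
  shows "[S = (- 1) ^ m * y * a] (mod n)"
proof -
  have "(- 1) ^ m * ((- 1) ^ m * S) = S" by (cases "even m") auto
  moreover have "[(- 1) ^ m * ((- 1) ^ m * S) = (- 1) ^ m * ((y * x) * S)] (mod n)"
    by (intro cong_mult cong_refl cong_sym[OF assms(2)])
  moreover have "[(- 1) ^ m * y * (x * S) = (- 1) ^ m * y * a] (mod n)"
    by (intro cong_mult cong_refl assms(1))
  ultimately show ?thesis by (simp only: mult.assoc) (rule cong_trans)
qed

lemma i_power_reduce: "\<i> ^ (4 * q + s) = \<i> ^ s"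
  by (simp add: power_add power_mult)

text \<open>Frobenius fixes the quartic character here. Multiplying by the cube of the Gauss sum
  avoids dividing by it: the exponent \<open>p + 3 = 4 * (q + 1)\<close> is a multiple of 4.\<close>

lemma binomial_sum_1_mod_4:
  assumes "prime p" "p \<noteq> 17" "p = 4 * q + 1" "[p = 3 ^ m] (mod 17)" "of_int a = Re (\<i> ^ (3 * m))"
  shows "[(\<Sum>k=0..p div 4. (-1) ^ k * int ((4 * k) choose (2 * k))) = (-1) ^ m * 17 ^ q * a] (mod int p)"
proof -
  have p2: "p \<noteq> 2" using assms(3) by presburger
  define J where "J = 1 - 4 * \<i>"
  obtain G where G: "G \<in> gauss_polys" and poly_G: "\<And>z. poly G z = gauss_sum17 \<i> z"
    by (rule gauss_sum17_poly) blast
  obtain S where S: "of_int S = Re (J ^ (2 * q))"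
    unfolding J_def using Re_power_1_minus_4i by metis
  have sum: "[(\<Sum>k=0..p div 4. (-1) ^ k * int ((4 * k) choose (2 * k))) = S] (mod int p)"
    using S assms(1,3) unfolding J_def by (intro binomial_sum_cong) auto
  have ip: "\<i> ^ p = \<i>" using i_power_reduce[of q 1] assms(3) by simp
  obtain r where r: "r \<in> gauss_polys" and r_eq: "\<And>z. z ^ 17 = 1 \<Longrightarrow>
      gauss_sum17 \<i> z ^ p = \<i> ^ (3 * m) * gauss_sum17 \<i> z + of_nat p * poly r z"
    using gauss_sum17_frobenius[OF assms(1,4)] unfolding ip by auto
  \<comment> \<open>The difference of the two evaluations of the \<open>(p + 3)\<close>-th power of
    the Gauss sum, which is independent of \<open>z\<close>.\<close>
  define c where "c = 17 * J^2 * (17 ^ q * J ^ (2 * q) - \<i> ^ (3 * m))"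
  have "c = of_nat p * poly (r * G ^ 3) z" if z: "z ^ 17 = 1" "z \<noteq> 1" for z
  proof -
    let ?g = "gauss_sum17 \<i> z"
    have g4: "?g ^ 4 = 17 * J^2" unfolding J_def by (rule gauss_sum17_power_4[OF z])
    have "?g ^ p * ?g ^ 3 = ?g ^ 4 * (?g ^ 4) ^ q"
      by (simp add: assms(3) flip: power_add power_mult power_Suc)
    also have "\<dots> = 17 * J^2 * (17 ^ q * J ^ (2 * q))"
      by (simp add: g4 power_mult_distrib flip: power_mult)
    finally have 1: "?g ^ p * ?g ^ 3 = 17 * J^2 * (17 ^ q * J ^ (2 * q))" .
    have "?g ^ p * ?g ^ 3 = \<i> ^ (3 * m) * ?g ^ 4 + of_nat p * (poly r z * ?g ^ 3)"
      by (simp add: r_eq[OF z(1)] algebra_simps eval_nat_numeral)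
    then show ?thesis using 1 unfolding g4 by (simp add: c_def poly_G algebra_simps)
  qed
  then obtain g where g: "g \<in> gauss_ints" "16 * c = of_nat p * g"
    using gauss_poly_constant_dvd[of "r * G ^ 3"] r G
    by (metis gauss_polys_mult gauss_polys_power)
  \<comment> \<open>Multiplying by the squared conjugate of \<open>J\<close> turns the factor
    \<open>17 * J^2\<close> into \<open>17 ^ 3\<close>.\<close>
  have "16 * 17 ^ 3 * (17 ^ q * J ^ (2 * q) - \<i> ^ (3 * m)) = 16 * c * (1 + 4 * \<i>) ^ 2"
  proof -
    have "J^2 * (1 + 4 * \<i>) ^ 2 = 17 ^ 2"
      unfolding J_def by (simp flip: power_mult_distrib add: algebra_simps)
    moreover have "16 * c * (1 + 4 * \<i>) ^ 2
        = 16 * 17 * (J^2 * (1 + 4 * \<i>) ^ 2) * (17 ^ q * J ^ (2 * q) - \<i> ^ (3 * m))"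
      unfolding c_def by (simp only: mult_ac)
    ultimately show ?thesis by simp
  qed
  also have "\<dots> = of_nat p * (g * (1 + 4 * \<i>) ^ 2)" by (simp add: g)
  finally have "16 * 17 ^ 3 * (17 ^ q * J ^ (2 * q) - \<i> ^ (3 * m)) = of_nat p * (g * (1 + 4 * \<i>) ^ 2)" .
  moreover have "g * (1 + 4 * \<i>) ^ 2 \<in> gauss_ints"
    by (intro gauss_ints_mult gauss_ints_power gauss_ints_add g gauss_ints_1 gauss_ints_i gauss_ints_numeral)
  moreover have "Re (17 ^ q * J ^ (2 * q) - \<i> ^ (3 * m)) = of_int (17 ^ q * S - a)"
  proof -
    have "Re (17 ^ q * J ^ (2 * q)) = Re (complex_of_real (17 ^ q) * J ^ (2 * q))" by simp
    also have "\<dots> = 17 ^ q * Re (J ^ (2 * q))"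
      by (simp only: times_complex.sel Re_complex_of_real Im_complex_of_real mult_zero_left diff_zero)
    finally show ?thesis by (simp add: S assms(5))
  qed
  ultimately have "int p dvd 17 ^ q * S - a"
    by (rule Re_dvd_of_gauss_multiple[OF assms(1) p2 assms(2)])
  then have "[17 ^ q * S = a] (mod int p)" by (simp add: cong_iff_dvd_diff)
  moreover have "[17 ^ q * 17 ^ q = (- 1) ^ m] (mod int p)"
    using seventeen_power_half_cong[OF assms(1) _ assms(4)] assms(3) by (simp add: mult_2 power_add)
  ultimately have "[S = (- 1) ^ m * 17 ^ q * a] (mod int p)" by (rule cong_solve_sign)
  with sum show ?thesis by (rule cong_trans)
qed

text \<open>Frobenius now conjugates the character, so one further factor of the Gauss sum suffices:
  the conjugate pair multiplies to 17, and \<open>p + 1 = 4 * (q + 1)\<close>.\<close>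

lemma binomial_sum_3_mod_4:
  assumes "prime p" "p \<noteq> 17" "p = 4 * q + 3" "[p = 3 ^ m] (mod 17)"
    and "of_int a = Re (\<i> ^ m * (1 + 4 * \<i>))"
  shows "[(\<Sum>k=0..p div 4. (-1) ^ k * int ((4 * k) choose (2 * k))) = (-1) ^ m * 17 ^ q * a] (mod int p)"
proof -
  have p2: "p \<noteq> 2" using assms(3) by presburger
  define J where "J = 1 - 4 * \<i>"
  obtain G where G: "G \<in> gauss_polys" and poly_G: "\<And>z. poly G z = gauss_sum17 \<i> z"
    by (rule gauss_sum17_poly) blast
  obtain S where S: "of_int S = Re (J ^ (2 * q + 1))"
    unfolding J_def using Re_power_1_minus_4i by metis
  have sum: "[(\<Sum>k=0..p div 4. (-1) ^ k * int ((4 * k) choose (2 * k))) = S] (mod int p)"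
    using assms(1,3) by (intro binomial_sum_cong[OF _ _ S[unfolded J_def]]) auto
  have ip: "\<i> ^ p = - \<i>" using i_power_reduce[of q 3] assms(3) by (simp add: eval_nat_numeral)
  have im: "(- \<i>) ^ (3 * m) = \<i> ^ m" by (simp only: power_mult) (simp add: power3_eq_cube)
  obtain r where r: "r \<in> gauss_polys" and r_eq: "\<And>z. z ^ 17 = 1 \<Longrightarrow>
      gauss_sum17 \<i> z ^ p = \<i> ^ m * gauss_sum17 (- \<i>) z + of_nat p * poly r z"
    using gauss_sum17_frobenius[OF assms(1,4)] unfolding ip im by auto
  define c where "c = 17 ^ (q + 1) * J ^ (2 * q + 1) * J - 17 * \<i> ^ m"
  have "c = of_nat p * poly (r * G) z" if z: "z ^ 17 = 1" "z \<noteq> 1" for z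
  proof -
    let ?g = "gauss_sum17 \<i> z"
    have g4: "?g ^ 4 = 17 * J^2" unfolding J_def by (rule gauss_sum17_power_4[OF z])
    have "?g ^ p * ?g = (?g ^ 4) ^ (q + 1)"
      by (simp add: assms(3) mult.commute flip: power_add power_mult power_Suc)
    also have "\<dots> = 17 ^ (q + 1) * (J ^ (2 * q + 1) * J)"
      by (simp add: g4 power_mult_distrib power2_eq_square mult_2 power_add)
    finally have 1: "?g ^ p * ?g = 17 ^ (q + 1) * (J ^ (2 * q + 1) * J)" .
    have "?g ^ p * ?g = \<i> ^ m * (?g * gauss_sum17 (- \<i>) z) + of_nat p * (poly r z * ?g)"
      by (simp add: r_eq[OF z(1)] algebra_simps)
    then show ?thesis
      using 1 unfolding gauss_sum17_mult_conjugate[OF z] by (simp add: c_def poly_G algebra_simps)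
  qed
  then obtain g where g: "g \<in> gauss_ints" "16 * c = of_nat p * g"
    using gauss_poly_constant_dvd[of "r * G"] r G by (metis gauss_polys_mult)
  \<comment> \<open>The conjugate of \<open>J\<close> cancels the extra \<open>J\<close> in the
    first term at the cost of 17, which then factors out of both terms.\<close>
  have "16 * 17 ^ 1 * (17 ^ (q + 1) * J ^ (2 * q + 1) - \<i> ^ m * (1 + 4 * \<i>)) = 16 * c * (1 + 4 * \<i>)"
  proof -
    have J: "J * (1 + 4 * \<i>) = 17" unfolding J_def by (simp add: algebra_simps)
    have "16 * c * (1 + 4 * \<i>) = 16 * (17 ^ (q + 1) * J ^ (2 * q + 1) * (J * (1 + 4 * \<i>))
        - 17 * (\<i> ^ m * (1 + 4 * \<i>)))"
      unfolding c_def by (simp only: left_diff_distrib right_diff_distrib mult_ac)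
    then show ?thesis unfolding J by (simp only: left_diff_distrib right_diff_distrib mult_ac power_one_right)
  qed
  also have "\<dots> = of_nat p * (g * (1 + 4 * \<i>))" by (simp add: g)
  finally have "16 * 17 ^ 1 * (17 ^ (q + 1) * J ^ (2 * q + 1) - \<i> ^ m * (1 + 4 * \<i>))
      = of_nat p * (g * (1 + 4 * \<i>))" .
  moreover have "g * (1 + 4 * \<i>) \<in> gauss_ints"
    by (intro gauss_ints_mult gauss_ints_add g gauss_ints_1 gauss_ints_i gauss_ints_numeral)
  moreover have "Re (17 ^ (q + 1) * J ^ (2 * q + 1) - \<i> ^ m * (1 + 4 * \<i>)) = of_int (17 ^ (q + 1) * S - a)"
  proof -
    have "Re (17 ^ (q + 1) * J ^ (2 * q + 1)) = Re (complex_of_real (17 ^ (q + 1)) * J ^ (2 * q + 1))"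
      by simp
    also have "\<dots> = 17 ^ (q + 1) * Re (J ^ (2 * q + 1))"
      by (simp only: times_complex.sel Re_complex_of_real Im_complex_of_real mult_zero_left diff_zero)
    finally show ?thesis by (simp only: S[symmetric] assms(5)[symmetric] minus_complex.sel) simp
  qed
  ultimately have "int p dvd 17 ^ (q + 1) * S - a"
    by (rule Re_dvd_of_gauss_multiple[OF assms(1) p2 assms(2)])
  then have "[17 ^ (q + 1) * S = a] (mod int p)" by (simp only: cong_iff_dvd_diff)
  \<comment> \<open>Here \<open>(p - 1) div 2\<close> is \<open>2 * q + 1\<close>, so
    \<open>17 ^ q\<close> inverts \<open>17 ^ (q + 1)\<close> up to sign.\<close>
  moreover have "[17 ^ q * 17 ^ (q + 1) = (- 1) ^ m] (mod int p)"
  proof -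
    have "(p - 1) div 2 = q + (q + 1)" "odd p" using assms(3) by auto
    then show ?thesis using seventeen_power_half_cong[OF assms(1) _ assms(4)] by (simp add: power_add mult.left_commute)
  qed
  ultimately have "[S = (- 1) ^ m * 17 ^ q * a] (mod int p)" by (rule cong_solve_sign)
  with sum show ?thesis by (rule cong_trans)
qed

section \<open>Cosets of the fourth powers modulo 17 and the final case distinction\<close>

text \<open>The fourth powers 1, -1, 4, -4 are generated by 3^4 = -4, and \<open>s\<close> names the
  coset of \<open>3 ^ s\<close>, on which the quartic character is \<open>\<i> ^ s\<close>.\<close>

lemma coset_mod_17:
  assumes "\<exists>a\<in>A. [int p = a] (mod 17)"
    and "(A, s) \<in> {({1, -1, 4, -4}, 0), ({3, -3, 5, -5}, 1), ({2, -2, 8, -8}, 2), ({6, -6, 7, -7}, 3)}"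
  shows "\<exists>r. [p = 3 ^ (4 * r + s)] (mod 17)"
proof -
  have "\<exists>r\<in>{0,1,2,3}. [a = 3 ^ (4 * r + s)] (mod 17)" if "a \<in> A" for a
    using assms(2) that by (auto simp: cong_def)
  then obtain r where "[int p = 3 ^ (4 * r + s)] (mod 17)" using assms(1) cong_trans by blast
  then have "[int p = int (3 ^ (4 * r + s))] (mod int 17)" by simp
  then show ?thesis unfolding cong_int_iff by blast
qed

theorem theorem2p6:
  fixes p :: nat
  assumes "prime p" and "odd p" and "p \<noteq> 17"
  shows
    "([p = 1] (mod 4) \<longrightarrow>
       ((\<exists>a\<in>{3, -3, 5, -5, 6, -6, 7, -7}. [int p = a] (mod 17)) \<longrightarrow>
          [(\<Sum>k=0..p div 4. (-1) ^ k * int ((4 * k) choose (2 * k))) = 0] (mod int p)) \<and>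
       ((\<exists>a\<in>{1, -1, 4, -4}. [int p = a] (mod 17)) \<longrightarrow>
          [(\<Sum>k=0..p div 4. (-1) ^ k * int ((4 * k) choose (2 * k))) = 17 ^ ((p - 1) div 4)] (mod int p)) \<and>
       ((\<exists>a\<in>{2, -2, 8, -8}. [int p = a] (mod 17)) \<longrightarrow>
          [(\<Sum>k=0..p div 4. (-1) ^ k * int ((4 * k) choose (2 * k))) = - (17 ^ ((p - 1) div 4))] (mod int p))) \<and>
     ([p = 3] (mod 4) \<longrightarrow>
       ((\<exists>a\<in>{1, -1, 4, -4}. [int p = a] (mod 17)) \<longrightarrow>
          [(\<Sum>k=0..p div 4. (-1) ^ k * int ((4 * k) choose (2 * k))) = 17 ^ ((p - 3) div 4)] (mod int p)) \<and>
       ((\<exists>a\<in>{2, -2, 8, -8}. [int p = a] (mod 17)) \<longrightarrow>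
          [(\<Sum>k=0..p div 4. (-1) ^ k * int ((4 * k) choose (2 * k))) = - (17 ^ ((p - 3) div 4))] (mod int p)) \<and>
       ((\<exists>a\<in>{3, -3, 5, -5}. [int p = a] (mod 17)) \<longrightarrow>
          [(\<Sum>k=0..p div 4. (-1) ^ k * int ((4 * k) choose (2 * k))) = 4 * 17 ^ ((p - 3) div 4)] (mod int p)) \<and>
       ((\<exists>a\<in>{6, -6, 7, -7}. [int p = a] (mod 17)) \<longrightarrow>
          [(\<Sum>k=0..p div 4. (-1) ^ k * int ((4 * k) choose (2 * k))) = - 4 * 17 ^ ((p - 3) div 4)] (mod int p)))"
proof -
  let ?S = "\<Sum>k=0..p div 4. (-1) ^ k * int ((4 * k) choose (2 * k))"
  let ?cosets = "{({1, -1, 4, -4}, 0), ({3, -3, 5, -5}, 1), ({2, -2, 8, -8}, 2), ({6, -6, 7, -7}, 3)}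
    :: (int set \<times> nat) set"
  \<comment> \<open>The discrete logarithm \<open>4 * r + s\<close> of \<open>p\<close> matters only
    modulo 4, as it enters through powers of \<open>\<i>\<close> and -1.\<close>
  have one: "[?S = (- 1) ^ s * 17 ^ ((p - 1) div 4) * a] (mod int p)"
    if p: "[p = 1] (mod 4)" and A: "\<exists>a\<in>A. [int p = a] (mod 17)" "(A, s) \<in> ?cosets"
      and a: "of_int a = Re (\<i> ^ (3 * s))" for A s a
  proof -
    obtain r where "[p = 3 ^ (4 * r + s)] (mod 17)" using coset_mod_17[OF A] by blast
    moreover have "of_int a = Re (\<i> ^ (3 * (4 * r + s)))"
      using a i_power_reduce[of "3 * r" "3 * s"] by (simp add: algebra_simps)
    moreover have "p = 4 * ((p - 1) div 4) + 1" using p unfolding cong_def by presburger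
    ultimately have "[?S = (- 1) ^ (4 * r + s) * 17 ^ ((p - 1) div 4) * a] (mod int p)"
      using assms by (intro binomial_sum_1_mod_4)
    then show ?thesis by (simp add: power_add)
  qed
  have three: "[?S = (- 1) ^ s * 17 ^ ((p - 3) div 4) * a] (mod int p)"
    if p: "[p = 3] (mod 4)" and A: "\<exists>a\<in>A. [int p = a] (mod 17)" "(A, s) \<in> ?cosets"
      and a: "of_int a = Re (\<i> ^ s * (1 + 4 * \<i>))" for A s a
  proof -
    obtain r where "[p = 3 ^ (4 * r + s)] (mod 17)" using coset_mod_17[OF A] by blast
    moreover have "of_int a = Re (\<i> ^ (4 * r + s) * (1 + 4 * \<i>))"
      unfolding i_power_reduce by (rule a)
    moreover have "p = 4 * ((p - 3) div 4) + 3" using p unfolding cong_def by presburger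
    ultimately have "[?S = (- 1) ^ (4 * r + s) * 17 ^ ((p - 3) div 4) * a] (mod int p)"
      using assms by (intro binomial_sum_3_mod_4)
    then show ?thesis by (simp add: power_add)
  qed
  have i3: "\<i> ^ 3 = - \<i>" "\<i> ^ 6 = - 1" "\<i> ^ 9 = \<i>" by (simp_all add: eval_nat_numeral)
  \<comment> \<open>The last arguments are the real parts of \<open>\<i> ^ (3 * s)\<close> and,
    below, of \<open>\<i> ^ s * (1 + 4 * \<i>)\<close>; the factor \<open>(- 1) ^ s\<close> then
    flips the signs for odd \<open>s\<close>.\<close>
  note one_cases = one[of "{1, -1, 4, -4}" 0 1] one[of "{3, -3, 5, -5}" 1 0]
    one[of "{2, -2, 8, -8}" 2 "-1"] one[of "{6, -6, 7, -7}" 3 0]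
  note three_cases = three[of "{1, -1, 4, -4}" 0 1] three[of "{3, -3, 5, -5}" 1 "-4"]
    three[of "{2, -2, 8, -8}" 2 "-1"] three[of "{6, -6, 7, -7}" 3 4]
  \<comment> \<open>The vanishing case joins the two odd cosets, where the character value is purely
    imaginary.\<close>
  have split: "(\<exists>a\<in>{3, -3, 5, -5, 6, -6, 7, -7}. P a) \<longleftrightarrow>
      (\<exists>a\<in>{3, -3, 5, -5}. P a) \<or> (\<exists>a\<in>{6, -6, 7, -7}. P a)" for P :: "int \<Rightarrow> bool"
    by blast
  show ?thesis
    unfolding split
    apply (intro conjI impI)
    subgoal using one_cases(2,4) by (elim disjE) (simp_all add: i3 del: bex_simps)
    subgoal using one_cases(1) by (simp add: i3 del: bex_simps)
    subgoal using one_cases(3) by (simp add: i3 del: bex_simps)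
    subgoal using three_cases(1) by (simp add: i3 del: bex_simps)
    subgoal using three_cases(3) by (simp add: i3 del: bex_simps)
    subgoal using three_cases(2) by (simp add: i3 mult.commute del: bex_simps)
    subgoal using three_cases(4) by (simp add: i3 mult.commute del: bex_simps)
    done
qed

end
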